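(* Let $m<n$ be positive integers, let $H\in\mathbb{R}^{n\times m}$, let $\mathbf{x}\in\mathbb{R}^m$, let $k$ be an integer, let $\mathbf{e}\in\mathbb{R}^n$ be a vector with $k$ nonzero entries, let $\mathbf{v}\in\mathbb{R}^n$ satisfy $\|\mathbf{v}\|_2\le\epsilon$, and put $\mathbf{y}=H\mathbf{x}+\mathbf{e}+\mathbf{v}$. Suppose that the minimum nonzero singular value of $H$ is $\sigma_{\min}$. Let $C$ be a real number larger than $1$, and suppose that every vector $\mathbf{w}$ in the subspace generated by $H$ satisfies $$C\|\mathbf{w}_K\|_1\le\|\mathbf{w}_{\overline{K}}\|_1$$ for any subset $K\subseteq\{1,\dots,n\}$ with cardinality $|K|\le k$, where $\overline{K}=\{1,\dots,n\}\setminus K$. Assume also that the subspace generated by $H$ satisfies the almost Euclidean property for a constant $0<\alpha\le 1$, namely $$\alpha\sqrt{n}\,\|\mathbf{w}\|_2\le\|\mathbf{w}\|_1$$ holds for every $\mathbf{w}$ in the subspace generated by $H$. Let $\hat{\mathbf{x}}$ be the optimizing value of $\mathbf{x}^*$ in the program $$\min_{\mathbf{x}^*\in\mathbb{R}^m,\ \mathbf{z}\in\mathbb{R}^n}\ \|\mathbf{y}-H\mathbf{x}^*-\mathbf{z}\|_1\quad\text{subject to}\quad\|\mathbf{z}\|_2\le\epsilon .$$ Then $$\|\mathbf{x}-\hat{\mathbf{x}}\|_2\le\frac{2(C+1)}{\sigma_{\min}\,\alpha\,(C-1)}\,\epsilon .$$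
   Context: For a vector $\mathbf{w}\in\mathbb{R}^n$ and an index set $K\subseteq\{1,\dots,n\}$, $\mathbf{w}_K$ denotes the part (restriction) of $\mathbf{w}$ over the indices in $K$, so $\|\mathbf{w}_K\|_1=\sum_{i\in K}|w_i|$. The subspace generated by $H$ is its column space $\{H\mathbf{u}:\mathbf{u}\in\mathbb{R}^m\}$. The number $\epsilon\ge 0$ is a bound on the Euclidean norm of the noise vector $\mathbf{v}$.
   Formalization: H is additionally assumed to have full column rank m; without this the optimizing value x̂ is never determined (adding a kernel vector of H to it gives another optimizer), and the bound fails for some optimizers. *)

theory Defs
  imports "HOL-Analysis.Analysis"
begin

definition l1_on :: "'n set \<Rightarrow> real ^ 'n \<Rightarrow> real" where
  "l1_on K w = (\<Sum>i\<in>K. \<bar>w $ i\<bar>)"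

abbreviation l1_norm :: "real ^ 'n \<Rightarrow> real" where
  "l1_norm w \<equiv> l1_on UNIV w"

definition col_space :: "real ^ 'm ^ 'n \<Rightarrow> (real ^ 'n) set" where
  "col_space H = range (\<lambda>u. H *v u)"

(* Square roots of the eigenvalues of H^T H.  If H has fewer rows than columns this set may
   contain 0 even when H has full row rank; the nonzero singular values are not affected. *)
definition singular_values :: "real ^ 'm ^ 'n \<Rightarrow> real set" where
  "singular_values H =
     {s. 0 \<le> s \<and> (\<exists>u. u \<noteq> 0 \<and> (transpose H ** H) *v u = s\<^sup>2 *\<^sub>R u)}"

(* Relational, because H = 0 has no nonzero singular value. *)
definition is_min_nonzero_singular_value :: "real ^ 'm ^ 'n \<Rightarrow> real \<Rightarrow> bool" where
  "is_min_nonzero_singular_value H s \<longleftrightarrow>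
     s \<in> singular_values H - {0} \<and> (\<forall>t \<in> singular_values H - {0}. s \<le> t)"

(* The minimisation is joint over the pair (x, z), so xh is an optimizing value of x
   if some zh completes it to a joint minimiser; xh need not be unique.  The bound is asserted
   for every such xh, which presupposes that H is injective: if H u = 0 with u nonzero, then xh + t u
   is optimizing for all t, whence the full column rank hypothesis in the theorem. *)
definition optimizing_value ::
    "real ^ 'm ^ 'n \<Rightarrow> real ^ 'n \<Rightarrow> real \<Rightarrow> real ^ 'm \<Rightarrow> bool" where
  "optimizing_value H y \<epsilon> xh \<longleftrightarrow>
     (\<exists>zh. is_arg_min (\<lambda>(x, z). l1_norm (y - H *v x - z)) (\<lambda>(x, z). norm z \<le> \<epsilon>) (xh, zh))"

end

theory Submission
  imports Defs
begin

text \<open>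
  Put \<open>w = H (x - xh)\<close> and let \<open>K\<close> be the support of \<open>e\<close>. Comparing the optimum with the feasible
  pair \<open>(x, v)\<close> gives \<open>l1 (w + e + v - zh) \<le> l1 e\<close>, whence the part of \<open>w\<close> off \<open>K\<close> exceeds the
  part on \<open>K\<close> by at most \<open>l1 (v - zh) \<le> 2 \<epsilon> sqrt n\<close>. The balancedness condition turns this into a
  bound on \<open>l1 w\<close>, the almost Euclidean property into one on \<open>norm w\<close>, and the smallest singular
  value into one on \<open>norm (x - xh)\<close>. That last step needs no spectral theorem: a minimiser of
  \<open>norm (H u)\<close> over the unit sphere is an eigenvector of \<open>H\<^sup>T H\<close> by the first-order condition.
\<close>

text \<open>First-order condition at a minimum. A nonzero \<open>a\<close> would make the quadratic
  negative at its vertex \<open>t = - a / b\<close> if \<open>b > 0\<close>, and at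
  \<open>t = - a\<close> otherwise.\<close>

lemma quadratic_nonneg_imp_linear_coeff_zero:
  fixes a b :: real
  assumes "\<And>t. 0 \<le> 2 * t * a + t\<^sup>2 * b"
  shows "a = 0"
proof (rule ccontr)
  assume "a \<noteq> 0"
  show False
  proof (cases "b > 0")
    case True
    have "2 * (- a / b) * a + (- a / b)\<^sup>2 * b = - (a\<^sup>2 / b)"
      using True by (simp add: field_simps power2_eq_square)
    moreover have "a\<^sup>2 / b > 0"
      using True \<open>a \<noteq> 0\<close> by simp
    ultimately show False
      using assms[of "- a / b"] by linarith
  next
    case False
    have "2 * (- a) * a + (- a)\<^sup>2 * b = - (a\<^sup>2 * (2 - b))"
      by (simp add: algebra_simps power2_eq_square)
    moreover have "a\<^sup>2 * (2 - b) > 0"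
      using False \<open>a \<noteq> 0\<close> by simp
    ultimately show False
      using assms[of "- a"] by linarith
  qed
qed

lemma power2_norm_add_scaleR:
  fixes a b :: "'a :: real_inner"
  shows "(norm (a + t *\<^sub>R b))\<^sup>2 = (norm a)\<^sup>2 + 2 * t * (a \<bullet> b) + t\<^sup>2 * (norm b)\<^sup>2"
  using dot_norm[of a "t *\<^sub>R b"] by (simp add: power_mult_distrib)

lemma inner_gram_matrix:
  fixes H :: "real ^ 'm ^ 'n"
  shows "((transpose H ** H) *v u) \<bullet> w = (H *v u) \<bullet> (H *v w)"
  by (metis dot_lmul_matrix matrix_vector_mul_assoc transpose_matrix_vector)

lemma least_singular_value:
  fixes H :: "real ^ 'm ^ 'n"
  obtains s where "s \<in> singular_values H" "\<And>u. s * norm u \<le> norm (H *v u)"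
proof -
  let ?S = "sphere (0 :: real ^ 'm) 1"
  have "axis (undefined :: 'm) 1 \<in> ?S"
    by (simp add: norm_axis_1)
  then have "?S \<noteq> {}" by blast
  moreover have "continuous_on ?S (\<lambda>u. norm (H *v u))"
    by (intro continuous_intros linear_continuous_on matrix_vector_mul_bounded_linear)
  ultimately obtain u0 where u0: "u0 \<in> ?S"
    and min: "\<And>u. u \<in> ?S \<Longrightarrow> norm (H *v u0) \<le> norm (H *v u)"
    using continuous_attains_inf[OF compact_sphere] by metis
  define s where "s = norm (H *v u0)"
  have bound: "s * norm u \<le> norm (H *v u)" for u
  proof (cases "u = 0")
    case False
    have "s \<le> norm (H *v (u /\<^sub>R norm u))"
      unfolding s_def using False by (intro min) simp
    also have "\<dots> = norm (H *v u) / norm u"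
      by (simp add: matrix_vector_mult_scaleR divide_inverse_commute)
    finally show ?thesis
      using False by (simp add: field_simps)
  qed simp
  \<comment> \<open>The residual of the eigenvector equation at \<open>u0\<close>. Perturbing
    \<open>u0\<close> in this very direction makes the linear coefficient equal to
    \<open>d \<bullet> d\<close>, so its vanishing forces \<open>d = 0\<close>.\<close>
  define d where "d = (transpose H ** H) *v u0 - s\<^sup>2 *\<^sub>R u0"
  have "0 \<le> 2 * t * (d \<bullet> d) + t\<^sup>2 * ((norm (H *v d))\<^sup>2 - s\<^sup>2 * (norm d)\<^sup>2)" for t
  proof -
    have "(s * norm (u0 + t *\<^sub>R d))\<^sup>2 \<le> (norm (H *v (u0 + t *\<^sub>R d)))\<^sup>2"
      using bound by (intro power_mono) (auto simp: s_def)
    moreover have "(norm (H *v (u0 + t *\<^sub>R d)))\<^sup>2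
        = s\<^sup>2 + 2 * t * ((H *v u0) \<bullet> (H *v d)) + t\<^sup>2 * (norm (H *v d))\<^sup>2"
      by (simp add: s_def matrix_vector_right_distrib matrix_vector_mult_scaleR power2_norm_add_scaleR)
    moreover have "(norm (u0 + t *\<^sub>R d))\<^sup>2 = 1 + 2 * t * (u0 \<bullet> d) + t\<^sup>2 * (norm d)\<^sup>2"
      using u0 by (simp add: power2_norm_add_scaleR)
    \<comment> \<open>Only the left factor of \<open>d \<bullet> d\<close> is unfolded;
      \<open>inner_gram_matrix\<close> then turns the Gram term into the left-hand side.\<close>
    moreover have "(H *v u0) \<bullet> (H *v d) = d \<bullet> d + s\<^sup>2 * (u0 \<bullet> d)"
      by (subst (2) d_def) (simp add: inner_diff_left inner_gram_matrix)
    ultimately show ?thesis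
      by (simp add: power_mult_distrib algebra_simps)
  qed
  then have "d = 0"
    using quadratic_nonneg_imp_linear_coeff_zero inner_eq_zero_iff by blast
  moreover have "u0 \<noteq> 0"
    using u0 by auto
  ultimately have "s \<in> singular_values H"
    by (auto simp: singular_values_def d_def s_def)
  with bound show ?thesis
    using that by blast
qed

text \<open>Injectivity excludes 0 as a singular value, so the least one is nonzero and hence at
  least \<open>\<sigma>\<close>.\<close>

lemma min_nonzero_singular_value_norm_le:
  fixes H :: "real ^ 'm ^ 'n"
  assumes "inj ((*v) H)" and "is_min_nonzero_singular_value H \<sigma>"
  shows "\<sigma> * norm u \<le> norm (H *v u)"
proof -
  obtain s where s: "s \<in> singular_values H" "\<And>u. s * norm u \<le> norm (H *v u)"
    using least_singular_value by blast
  have "s \<noteq> 0"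
  proof
    assume "s = 0"
    then obtain u where u: "u \<noteq> 0" "(transpose H ** H) *v u = 0"
      using s(1) by (auto simp: singular_values_def)
    then have "H *v u = H *v 0"
      using inner_gram_matrix[of H u u] by simp
    with u(1) show False
      using injD[OF assms(1)] by blast
  qed
  then have "\<sigma> \<le> s"
    using s(1) assms(2) by (auto simp: is_min_nonzero_singular_value_def)
  then have "\<sigma> * norm u \<le> s * norm u"
    by (simp add: mult_right_mono)
  also have "\<dots> \<le> norm (H *v u)" by (rule s(2))
  finally show ?thesis .
qed

lemma l1_norm_split: "l1_norm w = l1_on K w + l1_on (- K) w"
  unfolding l1_on_def by (simp add: Compl_eq_Diff_UNIV sum.subset_diff[of K UNIV])

lemma l1_on_triangle: "l1_on K (a + b) \<le> l1_on K a + l1_on K b"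
  unfolding l1_on_def sum.distrib[symmetric] by (intro sum_mono) simp

lemma l1_on_minus: "l1_on K (- a) = l1_on K a"
  by (simp add: l1_on_def)

text \<open>Cauchy-Schwarz against the all-ones vector.\<close>

lemma l1_norm_le_norm:
  fixes w :: "real ^ 'n"
  shows "l1_norm w \<le> sqrt (real CARD('n)) * norm w"
proof -
  have "(l1_norm w)\<^sup>2 \<le> (norm w)\<^sup>2 * real CARD('n)"
    using sum_squared_le_sum_of_squares[of "\<lambda>i. \<bar>w $ i\<bar>" "UNIV :: 'n set"]
    by (simp add: l1_on_def norm_vec_def L2_set_def sum_nonneg)
  then show ?thesis
    by (metis mult.commute norm_ge_zero real_le_rsqrt real_sqrt_mult real_sqrt_abs abs_of_nonneg)
qed

theorem mainTheorem1:
  fixes H :: "real ^ 'm ^ 'n"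
    and x xh :: "real ^ 'm"
    and e v y :: "real ^ 'n"
    and k :: nat
    and \<epsilon> \<sigma>_min C \<alpha> :: real
  assumes "CARD('m) < CARD('n)"
    and "rank H = CARD('m)"
    and "card {i. e $ i \<noteq> 0} = k"
    and "norm v \<le> \<epsilon>"
    and "y = H *v x + e + v"
    and "is_min_nonzero_singular_value H \<sigma>_min"
    and "C > 1"
    and "\<forall>w \<in> col_space H. \<forall>K. card K \<le> k \<longrightarrow> C * l1_on K w \<le> l1_on (- K) w"
    and "0 < \<alpha>" and "\<alpha> \<le> 1"
    and "\<forall>w \<in> col_space H. \<alpha> * sqrt (real CARD('n)) * norm w \<le> l1_norm w"
    and "optimizing_value H y \<epsilon> xh"
  shows "norm (x - xh) \<le> 2 * (C + 1) / (\<sigma>_min * \<alpha> * (C - 1)) * \<epsilon>"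
proof -
  let ?n = "real CARD('n)"
  obtain zh where zh: "norm zh \<le> \<epsilon>"
    and opt: "\<And>x' z. norm z \<le> \<epsilon> \<Longrightarrow> l1_norm (y - H *v xh - zh) \<le> l1_norm (y - H *v x' - z)"
    using assms(12) by (force simp: optimizing_value_def is_arg_min_def not_less)
  define w where "w = H *v (x - xh)"
  define K where "K = {i. e $ i \<noteq> 0}"
  let ?a = "l1_on K w" and ?b = "l1_on (- K) w"
  have w: "w \<in> col_space H"
    by (simp add: w_def col_space_def)
  have balanced: "C * ?a \<le> ?b"
    using assms(8) w assms(3) by (simp add: K_def)
  \<comment> \<open>The pair \<open>(x, v)\<close> leaves exactly the residual \<open>e\<close>,
    while the residual of the optimum is \<open>w + e + (v - zh)\<close>.\<close>
  have "l1_norm (w + e + (v - zh)) \<le> l1_norm e"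
    using opt[OF assms(4), of x] assms(5)
    by (simp add: w_def matrix_vector_mult_diff_distrib algebra_simps)
  moreover have "l1_norm (w + e) \<le> l1_norm (w + e + (v - zh)) + l1_norm (v - zh)"
    using l1_on_triangle[of UNIV "w + e + (v - zh)" "- (v - zh)"] by (simp only: l1_on_minus) simp
  moreover have "l1_norm (v - zh) \<le> sqrt ?n * (2 * \<epsilon>)"
  proof -
    have "norm (v - zh) \<le> 2 * \<epsilon>"
      using norm_triangle_ineq4[of v zh] zh assms(4) by linarith
    then have "sqrt ?n * norm (v - zh) \<le> sqrt ?n * (2 * \<epsilon>)"
      by (intro mult_left_mono) auto
    then show ?thesis
      using l1_norm_le_norm[of "v - zh"] by linarith
  qed
  \<comment> \<open>Off \<open>K\<close> the vector \<open>e\<close> vanishes, so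
    \<open>w + e\<close> agrees with \<open>w\<close> there; on \<open>K\<close> the reverse
    triangle inequality loses at most \<open>?a\<close>.\<close>
  moreover have "l1_norm e - ?a + ?b \<le> l1_norm (w + e)"
  proof -
    have "l1_on (- K) (w + e) = ?b" "l1_on (- K) e = 0"
      by (simp_all add: l1_on_def K_def)
    moreover have "l1_on K e \<le> l1_on K (w + e) + ?a"
      using l1_on_triangle[of K "w + e" "- w"] by (simp add: l1_on_minus)
    ultimately show ?thesis
      using l1_norm_split[of "w + e" K] l1_norm_split[of e K] by linarith
  qed
  ultimately have gap: "?b - ?a \<le> sqrt ?n * (2 * \<epsilon>)"
    by linarith
  \<comment> \<open>The right side minus the left side is \<open>2 * (?b - C * ?a)\<close>, which is
    nonnegative by \<open>balanced\<close>.\<close>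
  have "(C - 1) * l1_norm w \<le> (C + 1) * (?b - ?a)"
    using balanced l1_norm_split[of w K] by (simp add: algebra_simps)
  also have "\<dots> \<le> (C + 1) * (sqrt ?n * (2 * \<epsilon>))"
    using gap assms(7) by (intro mult_left_mono) auto
  finally have l1: "(C - 1) * l1_norm w \<le> (C + 1) * (sqrt ?n * (2 * \<epsilon>))" .
  have "(C - 1) * (\<alpha> * sqrt ?n * norm w) \<le> (C - 1) * l1_norm w"
    using assms(7,11) w by (intro mult_left_mono) auto
  \<comment> \<open>The factor \<open>sqrt ?n\<close> from the noise bound meets the one from the
    almost Euclidean property; cancelling it makes the final bound independent of the
    dimension.\<close>
  with l1 have "sqrt ?n * ((C - 1) * \<alpha> * norm w) \<le> sqrt ?n * (2 * (C + 1) * \<epsilon>)"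
    by (simp add: algebra_simps)
  then have norm_w: "(C - 1) * \<alpha> * norm w \<le> 2 * (C + 1) * \<epsilon>"
    by (simp add: mult_le_cancel_left)
  have "inj ((*v) H)"
    using assms(2) by (simp add: full_rank_injective)
  then have "\<sigma>_min * norm (x - xh) \<le> norm w"
    unfolding w_def using assms(6) by (rule min_nonzero_singular_value_norm_le)
  then have "(C - 1) * \<alpha> * (\<sigma>_min * norm (x - xh)) \<le> (C - 1) * \<alpha> * norm w"
    using assms(7,9) by (intro mult_left_mono) auto
  with norm_w have "(\<sigma>_min * \<alpha> * (C - 1)) * norm (x - xh) \<le> 2 * (C + 1) * \<epsilon>"
    by (simp add: algebra_simps)
  moreover have "\<sigma>_min > 0"
    using assms(6) by (auto simp: is_min_nonzero_singular_value_def singular_values_def)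
  ultimately show ?thesis
    using assms(7,9) by (simp add: pos_le_divide_eq mult.commute)
qed

end
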